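(* Let $\psi:\mathbb{S}^{n}_{++}\to\mathbb{R}$ be a mirror map and let $X,Y\in\mathbb{S}^{n}_{++}$. The canonical forward symmetrized Bregman divergence is the Stein (Jensen-Shannon) symmetrization: $$D_{\psi}^{\overrightarrow{\mathrm{symm}}}(X,Y;\overrightarrow{M}_{\mathrm{canonical}})=\frac{\psi(X)+\psi(Y)}{2}-\psi\left(\frac{X+Y}{2}\right),$$ where $\overrightarrow{M}_{\mathrm{canonical}}:=\arg\min_{M\in\mathcal{M}}D_{\psi}^{\overrightarrow{\mathrm{symm}}}(X,Y;M)$.
   Context: $\mathbb{S}^{n}$ is the set of real symmetric $n\times n$ matrices, $\mathbb{S}^{n}_{++}\subset\mathbb{S}^n$ is the open convex cone of positive definite ones, $\langle A,B\rangle=\mathrm{trace}(AB)$ is the Frobenius inner product on $\mathbb{S}^n$, $\preceq$ is the Löwner partial order, and $\mathrm{GL}(n)$ is the group of invertible real $n\times n$ matrices. Mirror map: a function $\psi:\mathbb{S}^{n}_{++}\to\mathbb{R}$ of Legendre type, meaning that $\psi$ is closed, proper, strictly convex and twice continuously differentiable on $\mathbb{S}^{n}_{++}$, that its gradient $\nabla\psi$ (with respect to $\langle\cdot,\cdot\rangle$) is a diffeomorphism from $\mathbb{S}^{n}_{++}$ onto its range in $\mathbb{S}^n$, and that $\|\nabla\psi(X)\|_2\to\infty$ as $X$ tends to the boundary of the closure of $\mathbb{S}^{n}_{++}$. Bregman divergence induced by $\psi$: $D_{\psi}(X,Y):=\psi(X)-\{\psi(Y)+\langle\nabla\psi(Y),X-Y\rangle\}$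 for $X,Y\in\mathbb{S}^{n}_{++}$. Mean on $\mathbb{S}^{n}_{++}$: a map $M:\mathbb{S}^{n}_{++}\times\mathbb{S}^{n}_{++}\to\mathbb{S}^{n}_{++}$ such that for all $A,B\in\mathbb{S}^{n}_{++}$: (i) $M(A,B)\succ0$; (ii) $M(A,B)=M(B,A)$; (iii) $A\preceq B$ implies $A\preceq M(A,B)\preceq B$; (iv) $M(A,B)$ is operator monotone increasing in $A$ and in $B$ (i.e. nondecreasing for $\preceq$ in each argument); (v) $M(P^{\top}AP,P^{\top}BP)=P^{\top}M(A,B)P$ for all $P\in\mathrm{GL}(n)$; (vi) $M(A,B)$ is continuous in $A,B$. $\mathcal{M}$ denotes the set of all means on $\mathbb{S}^{n}_{++}$. Forward symmetrized Bregman divergence: $D_{\psi}^{\overrightarrow{\mathrm{symm}}}(X,Y;M):=\frac12\{D_{\psi}(X,M(X,Y))+D_{\psi}(Y,M(X,Y))\}$. For fixed $X,Y$ it depends on $M$ only through the matrix $M(X,Y)$, and $\overrightarrow{M}_{\mathrm{canonical}}$ is identified with this matrix. The canonical forward symmetrized Bregman divergence is the value of $D_{\psi}^{\overrightarrow{\mathrm{symm}}}(X,Y;\cdot)$ at $\overrightarrow{M}_{\mathrm{canonical}}$. *)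

theory Defs
  imports "HOL-Analysis.Analysis"
begin

definition sym_mats :: "(real^'n^'n) set" where
  "sym_mats = {A. transpose A = A}"

definition psd :: "real^'n^'n \<Rightarrow> bool" where
  "psd A \<longleftrightarrow> A \<in> sym_mats \<and> (\<forall>x. 0 \<le> x \<bullet> (A *v x))"

definition spd_mats :: "(real^'n^'n) set" where
  "spd_mats = {A \<in> sym_mats. \<forall>x. x \<noteq> 0 \<longrightarrow> 0 < x \<bullet> (A *v x)}"

definition loewner_le :: "real^'n^'n \<Rightarrow> real^'n^'n \<Rightarrow> bool"  (infix "\<preceq>" 50) where
  "A \<preceq> B \<longleftrightarrow> psd (B - A)"

definition frob :: "real^'n^'n \<Rightarrow> real^'n^'n \<Rightarrow> real" where
  "frob A B = trace (A ** B)"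

text \<open>
  Derivatives are taken within the cone of positive definite matrices, which is relatively open in
  the space of symmetric matrices; since \<open>G\<close> is required to be symmetric, it is determined
  uniquely.
\<close>

definition has_gradient :: "(real^'n^'n \<Rightarrow> real) \<Rightarrow> real^'n^'n \<Rightarrow> real^'n^'n \<Rightarrow> bool" where
  "has_gradient \<psi> G X \<longleftrightarrow>
     G \<in> sym_mats \<and> (\<psi> has_derivative (\<lambda>H. frob G H)) (at X within spd_mats)"

definition grad :: "(real^'n^'n \<Rightarrow> real) \<Rightarrow> real^'n^'n \<Rightarrow> real^'n^'n" where
  "grad \<psi> X = (THE G. has_gradient \<psi> G X)"

definition C1_on :: "'a::real_normed_vector set \<Rightarrow> ('a \<Rightarrow> 'b::real_normed_vector) \<Rightarrow> bool" where
  "C1_on S f \<longleftrightarrow>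
     (\<exists>f' :: 'a \<Rightarrow> 'a \<Rightarrow>\<^sub>L 'b.
        (\<forall>x\<in>S. (f has_derivative blinfun_apply (f' x)) (at x within S)) \<and> continuous_on S f')"

definition diffeomorphism_on ::
  "'a::real_normed_vector set \<Rightarrow> 'b::real_normed_vector set \<Rightarrow> ('a \<Rightarrow> 'b) \<Rightarrow> bool" where
  "diffeomorphism_on S T f \<longleftrightarrow> (\<exists>g. homeomorphism S T f g \<and> C1_on S f \<and> C1_on T g)"

definition strictly_convex_on :: "'a::real_vector set \<Rightarrow> ('a \<Rightarrow> real) \<Rightarrow> bool" where
  "strictly_convex_on S f \<longleftrightarrow> convex S \<and>
     (\<forall>x\<in>S. \<forall>y\<in>S. \<forall>u>0. \<forall>v>0. x \<noteq> y \<longrightarrow> u + v = 1 \<longrightarrow>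
        f (u *\<^sub>R x + v *\<^sub>R y) < u * f x + v * f y)"

text \<open>
  As usual for functions of Legendre type, \<open>\<psi>\<close> on the relatively open set \<open>C\<close> is regarded as the
  restriction of a closed proper convex function with values in \<open>(-\<infinity>, \<infinity>]\<close> whose effective domain
  \<open>D\<close> has relative interior \<open>C\<close>.  Such a function is represented by its real values \<open>\<phi>\<close> on \<open>D\<close>
  (it is \<open>\<infinity>\<close> off \<open>D\<close>); it is proper iff \<open>D\<close> is nonempty and closed iff its epigraph is.
  Finite limits of \<open>\<psi>\<close> at boundary points of \<open>C\<close> are therefore allowed, as for
  \<open>trace (X log X - X)\<close>.
\<close>

definition closed_proper_on :: "'a::euclidean_space set \<Rightarrow> ('a \<Rightarrow> real) \<Rightarrow> bool" where
  "closed_proper_on C \<psi> \<longleftrightarrow>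
     (\<exists>D \<phi>. rel_interior D = C \<and> (\<forall>x\<in>C. \<phi> x = \<psi> x) \<and>
        convex_on D \<phi> \<and> D \<noteq> {} \<and> closed (epigraph D \<phi>))"

definition mirror_map :: "(real^'n^'n \<Rightarrow> real) \<Rightarrow> bool" where
  "mirror_map \<psi> \<longleftrightarrow>
     closed_proper_on spd_mats \<psi> \<and>
     strictly_convex_on spd_mats \<psi> \<and>
     (\<forall>X\<in>spd_mats. \<exists>G. has_gradient \<psi> G X) \<and>
     C1_on spd_mats (grad \<psi>) \<and>
     diffeomorphism_on spd_mats (grad \<psi> ` spd_mats) (grad \<psi>) \<and>
     (\<forall>Z \<in> rel_frontier (closure spd_mats).
        filterlim (\<lambda>X. norm (grad \<psi> X)) at_top (at Z within spd_mats))"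

definition bregman :: "(real^'n^'n \<Rightarrow> real) \<Rightarrow> real^'n^'n \<Rightarrow> real^'n^'n \<Rightarrow> real" where
  "bregman \<psi> X Y = \<psi> X - (\<psi> Y + frob (grad \<psi> Y) (X - Y))"

text \<open>The values of \<open>M\<close> outside the positive definite matrices are unconstrained and never used.\<close>

definition is_mean :: "(real^'n^'n \<Rightarrow> real^'n^'n \<Rightarrow> real^'n^'n) \<Rightarrow> bool" where
  "is_mean M \<longleftrightarrow>
     (\<forall>A\<in>spd_mats. \<forall>B\<in>spd_mats. M A B \<in> spd_mats) \<and>
     (\<forall>A\<in>spd_mats. \<forall>B\<in>spd_mats. M A B = M B A) \<and>
     (\<forall>A\<in>spd_mats. \<forall>B\<in>spd_mats. A \<preceq> B \<longrightarrow> A \<preceq> M A B \<and> M A B \<preceq> B) \<and>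
     (\<forall>A\<in>spd_mats. \<forall>A'\<in>spd_mats. \<forall>B\<in>spd_mats. A \<preceq> A' \<longrightarrow> M A B \<preceq> M A' B) \<and>
     (\<forall>A\<in>spd_mats. \<forall>B\<in>spd_mats. \<forall>B'\<in>spd_mats. B \<preceq> B' \<longrightarrow> M A B \<preceq> M A B') \<and>
     (\<forall>A\<in>spd_mats. \<forall>B\<in>spd_mats. \<forall>P. invertible P \<longrightarrow>
        M (transpose P ** A ** P) (transpose P ** B ** P) = transpose P ** M A B ** P) \<and>
     continuous_on (spd_mats \<times> spd_mats) (\<lambda>(A, B). M A B)"

text \<open>The forward symmetrized divergence as a function of the matrix \<open>K = M X Y\<close>.\<close>

definition fwd_symm_at ::
  "(real^'n^'n \<Rightarrow> real) \<Rightarrow> real^'n^'n \<Rightarrow> real^'n^'n \<Rightarrow> real^'n^'n \<Rightarrow> real" where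
  "fwd_symm_at \<psi> X Y K = (1/2) * (bregman \<psi> X K + bregman \<psi> Y K)"

definition fwd_symm ::
  "(real^'n^'n \<Rightarrow> real) \<Rightarrow> real^'n^'n \<Rightarrow> real^'n^'n \<Rightarrow>
   (real^'n^'n \<Rightarrow> real^'n^'n \<Rightarrow> real^'n^'n) \<Rightarrow> real" where
  "fwd_symm \<psi> X Y M = fwd_symm_at \<psi> X Y (M X Y)"

text \<open>
  Minimizing means are not unique as maps; the canonical mean is identified with their common value
  at \<open>(X, Y)\<close>.
\<close>

definition is_fwd_canonical ::
  "(real^'n^'n \<Rightarrow> real) \<Rightarrow> real^'n^'n \<Rightarrow> real^'n^'n \<Rightarrow> real^'n^'n \<Rightarrow> bool" where
  "is_fwd_canonical \<psi> X Y K \<longleftrightarrow>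
     (\<exists>M. is_arg_min (fwd_symm \<psi> X Y) is_mean M \<and> K = M X Y)"

definition fwd_canonical ::
  "(real^'n^'n \<Rightarrow> real) \<Rightarrow> real^'n^'n \<Rightarrow> real^'n^'n \<Rightarrow> real^'n^'n" where
  "fwd_canonical \<psi> X Y = (THE K. is_fwd_canonical \<psi> X Y K)"

end

theory Submission
  imports Defs
begin

text \<open>
  With \<open>A = (X + Y) / 2\<close>, the symmetrized divergence at \<open>K\<close> equals
  \<open>(\<psi> X + \<psi> Y) / 2 - \<psi> A + bregman \<psi> A K\<close>. By strict convexity the Bregman divergence is
  nonnegative and vanishes only at \<open>K = A\<close>, and \<open>A\<close> is the value of a mean, namely the
  arithmetic one.
\<close>

text \<open>Convexity keeps the segment from \<open>x\<close> to \<open>y\<close> inside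
  \<open>S\<close>, so the chain rule along it needs only the derivative within \<open>S\<close>. No
  openness of \<open>S\<close> is assumed: for n > 1 the positive definite cone has empty interior
  among all matrices.\<close>

lemma tendsto_directional_derivative:
  fixes f :: "'a::real_normed_vector \<Rightarrow> real"
  assumes f: "(f has_derivative f') (at x within S)"
    and S: "convex S" "x \<in> S" "y \<in> S"
  shows "((\<lambda>t. (f (x + t *\<^sub>R (y - x)) - f x) / t) \<longlongrightarrow> f' (y - x)) (at_right 0)"
proof -
  let ?g = "\<lambda>t::real. x + t *\<^sub>R (y - x)"
  have "x + t *\<^sub>R (y - x) \<in> S" if "t \<in> {0..1}" for t
  proof -
    have "x + t *\<^sub>R (y - x) = (1 - t) *\<^sub>R x + t *\<^sub>R y"
      by (simp add: algebra_simps)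
    then show ?thesis
      using S that by (auto simp: convex_alt)
  qed
  then have "?g ` {0..1} \<subseteq> S"
    by blast
  then have "(f has_derivative f') (at (?g 0) within ?g ` {0..1})"
    using f by (auto intro: has_derivative_subset)
  moreover have "(?g has_derivative (\<lambda>t. t *\<^sub>R (y - x))) (at 0 within {0..1})"
    by (auto intro!: derivative_eq_intros)
  ultimately have "((f \<circ> ?g) has_derivative (f' \<circ> (\<lambda>t. t *\<^sub>R (y - x)))) (at 0 within {0..1})"
    by (rule diff_chain_within[rotated])
  \<comment> \<open>On the line, the linear map \<open>f'\<close> is multiplication by the number
    \<open>f' (y - x)\<close>, so the composite has an ordinary real derivative and the claim is
    about its difference quotient.\<close>
  moreover have "f' \<circ> (\<lambda>t. t *\<^sub>R (y - x)) = (*) (f' (y - x))"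
    using linear_scale[OF has_derivative_linear[OF f]] by (auto simp: mult.commute)
  ultimately have "((f \<circ> ?g) has_real_derivative f' (y - x)) (at 0 within {0..1})"
    by (simp add: has_field_derivative_def)
  then show ?thesis
    by (simp add: has_field_derivative_iff at_within_Icc_at_right)
qed

text \<open>Convexity bounds the difference quotients along a segment, but passing to the limit
  loses strictness. It is recovered by using the weak inequality at the midpoint and strict
  convexity between \<open>x\<close> and \<open>y\<close>.\<close>

lemma strictly_convex_on_above_tangent:
  assumes sc: "strictly_convex_on S f"
    and f: "(f has_derivative f') (at x within S)"
    and S: "x \<in> S" "y \<in> S" and "x \<noteq> y"
  shows "f x + f' (y - x) < f y"
proof -
  have conv: "convex S"
    using sc by (simp add: strictly_convex_on_def)
  have less: "f (u *\<^sub>R x + v *\<^sub>R z) < u * f x + v * f z"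
    if "z \<in> S" "x \<noteq> z" "0 < u" "0 < v" "u + v = 1" for u v z
    using sc S(1) that by (simp add: strictly_convex_on_def)
  have le: "f' (z - x) \<le> f z - f x" if z: "z \<in> S" "x \<noteq> z" for z
  proof (rule tendsto_upperbound[OF tendsto_directional_derivative[OF f conv S(1) z(1)]])
    have "(f (x + t *\<^sub>R (z - x)) - f x) / t \<le> f z - f x" if t: "0 < t" "t < 1" for t
    proof -
      have "f ((1 - t) *\<^sub>R x + t *\<^sub>R z) < (1 - t) * f x + t * f z"
        using z t by (intro less) simp_all
      moreover have "x + t *\<^sub>R (z - x) = (1 - t) *\<^sub>R x + t *\<^sub>R z"
        by (simp add: algebra_simps)
      ultimately show ?thesis
        using t by (simp add: field_simps)
    qed
    then show "\<forall>\<^sub>F t in at_right 0. (f (x + t *\<^sub>R (z - x)) - f x) / t \<le> f z - f x"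
      by (auto simp: eventually_at_right[of 0 1] intro: exI[of _ 1])
  qed simp
  define m where "m = (1/2) *\<^sub>R x + (1/2) *\<^sub>R y"
  have "m \<in> S"
    using conv S by (simp add: m_def convexD)
  have mx: "m - x = (1/2) *\<^sub>R (y - x)"
    by (simp add: m_def algebra_simps flip: scaleR_add_left)
  then have "x \<noteq> m"
    using \<open>x \<noteq> y\<close> by auto
  have "f' (m - x) = (1/2) * f' (y - x)"
    unfolding mx using linear_scale[OF has_derivative_linear[OF f]] by simp
  then have "(1/2) * f' (y - x) \<le> f m - f x"
    using le[OF \<open>m \<in> S\<close> \<open>x \<noteq> m\<close>] by simp
  moreover have "f m < (1/2) * f x + (1/2) * f y"
    unfolding m_def using S \<open>x \<noteq> y\<close> by (intro less) simp_all
  ultimately show ?thesis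
    by simp
qed

text \<open>Symmetry of \<open>G\<close> alone turns the sum of \<open>G $ i $ k * H $ k $ i\<close>
  into the entrywise inner product; \<open>H\<close> may be arbitrary.\<close>

lemma frob_eq_inner: "G \<in> sym_mats \<Longrightarrow> frob G H = G \<bullet> H"
proof -
  assume "G \<in> sym_mats"
  then have "G $ i $ k = G $ k $ i" for i k
    by (metis (mono_tags) mem_Collect_eq sym_mats_def transpose_def vec_lambda_beta)
  then show ?thesis
    unfolding frob_def trace_def matrix_matrix_mult_def inner_vec_def
    by (simp, subst sum.swap, simp)
qed

lemma sym_mats_add: "A \<in> sym_mats \<Longrightarrow> B \<in> sym_mats \<Longrightarrow> A + B \<in> sym_mats"
  by (simp add: sym_mats_def transpose_def vec_eq_iff)

lemma sym_mats_diff: "A \<in> sym_mats \<Longrightarrow> B \<in> sym_mats \<Longrightarrow> A - B \<in> sym_mats"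
  by (simp add: sym_mats_def transpose_def vec_eq_iff)

lemma sym_mats_scaleR: "A \<in> sym_mats \<Longrightarrow> c *\<^sub>R A \<in> sym_mats"
  by (simp add: sym_mats_def transpose_def vec_eq_iff)

lemma spd_mats_add_psd:
  assumes "A \<in> spd_mats" "psd B"
  shows "A + B \<in> spd_mats"
  using assms
  by (auto simp: spd_mats_def psd_def sym_mats_add matrix_vector_mult_add_rdistrib inner_add_right
      intro: add_pos_nonneg)

lemma spd_mats_imp_psd: "A \<in> spd_mats \<Longrightarrow> psd A"
  unfolding spd_mats_def psd_def by (auto simp: less_imp_le) (metis inner_zero_left less_eq_real_def)

lemma psd_scaleR: "psd A \<Longrightarrow> 0 \<le> c \<Longrightarrow> psd (c *\<^sub>R A)"
  by (simp add: psd_def sym_mats_scaleR flip: scaleR_matrix_vector_assoc)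

lemma spd_mats_scaleR: "A \<in> spd_mats \<Longrightarrow> 0 < c \<Longrightarrow> c *\<^sub>R A \<in> spd_mats"
  by (simp add: spd_mats_def sym_mats_scaleR flip: scaleR_matrix_vector_assoc)

lemma spd_mats_add: "A \<in> spd_mats \<Longrightarrow> B \<in> spd_mats \<Longrightarrow> A + B \<in> spd_mats"
  by (simp add: spd_mats_add_psd spd_mats_imp_psd)

lemma matrix_add_rdistrib: "(A + B) ** C = A ** C + B ** C"
  by (simp add: vec_eq_iff matrix_matrix_mult_def distrib_right sum.distrib)

lemma psd_square: "N \<in> sym_mats \<Longrightarrow> psd (N ** N)"
proof -
  assume N: "N \<in> sym_mats"
  then have t: "transpose N = N"
    by (simp add: sym_mats_def)
  then have "x \<bullet> ((N ** N) *v x) = (N *v x) \<bullet> (N *v x)" for x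
    by (metis dot_lmul_matrix matrix_vector_mul_assoc vector_transpose_matrix)
  with t show ?thesis
    by (simp add: psd_def sym_mats_def matrix_transpose_mul)
qed

text \<open>A derivative within the cone is tested only along directions staying in the cone. The
  difference \<open>H\<close> of two gradients is orthogonal to all differences of points of the
  cone, and a multiple of \<open>H\<close> is itself such a difference, so \<open>H\<close> is
  orthogonal to itself.\<close>

lemma has_gradient_unique:
  assumes conv: "convex (spd_mats :: (real^'n^'n) set)"
    and K: "(K :: real^'n^'n) \<in> spd_mats"
    and G1: "has_gradient \<psi> G1 K" and G2: "has_gradient \<psi> G2 K"
  shows "G1 = G2"
proof -
  define H where "H = G1 - G2"
  have sym: "G1 \<in> sym_mats" "G2 \<in> sym_mats"
    using G1 G2 by (auto simp: has_gradient_def)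
  have H: "H \<in> sym_mats"
    unfolding H_def using sym by (rule sym_mats_diff)
  have orth: "H \<bullet> Z = H \<bullet> K" if Z: "Z \<in> spd_mats" for Z
  proof -
    \<comment> \<open>The difference quotients do not involve the gradient, so both values are
      limits of the same function.\<close>
    have "frob G1 (Z - K) = frob G2 (Z - K)"
    proof (rule tendsto_unique)
      show "((\<lambda>t. (\<psi> (K + t *\<^sub>R (Z - K)) - \<psi> K) / t) \<longlongrightarrow> frob G1 (Z - K)) (at_right 0)"
        "((\<lambda>t. (\<psi> (K + t *\<^sub>R (Z - K)) - \<psi> K) / t) \<longlongrightarrow> frob G2 (Z - K)) (at_right 0)"
        using G1 G2 unfolding has_gradient_def
        by (auto intro: tendsto_directional_derivative[OF _ conv K Z])
    qed simp
    then show ?thesis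
      using sym by (simp add: frob_eq_inner H_def inner_diff_left inner_diff_right)
  qed
  \<comment> \<open>\<open>4 H\<close> is a difference of squares, hence of two positive definite matrices.\<close>
  have I: "mat 1 \<in> (sym_mats :: (real^'n^'n) set)"
    by (simp add: sym_mats_def)
  let ?P = "K + (mat 1 + H) ** (mat 1 + H)" and ?Q = "K + (mat 1 - H) ** (mat 1 - H)"
  have "?P \<in> spd_mats" "?Q \<in> spd_mats"
    using K I H by (simp_all add: spd_mats_add_psd psd_square sym_mats_add sym_mats_diff)
  from orth[OF this(1)] orth[OF this(2)] have "H \<bullet> (?P - ?Q) = 0"
    by (simp only: inner_diff_right)
  moreover have "?P - ?Q = 4 *\<^sub>R H"
  proof -
    \<comment> \<open>The scalar \<open>c\<close> lets one expansion serve both signs,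
      \<open>c = 1\<close> and \<open>c = -1\<close>; in the difference the even terms
      cancel.\<close>
    have square: "(mat 1 + c *\<^sub>R H) ** (mat 1 + c *\<^sub>R H)
        = mat 1 + (2 * c) *\<^sub>R H + c\<^sup>2 *\<^sub>R (H ** H)" for c
      by (simp only: matrix_add_ldistrib matrix_add_rdistrib matrix_scalar_ac
          scalar_matrix_assoc[symmetric] matrix_mul_lid matrix_mul_rid)
        (simp add: vec_eq_iff power2_eq_square algebra_simps)
    have "(mat 1 + H) ** (mat 1 + H) = mat 1 + 2 *\<^sub>R H + H ** H"
      using square[of 1] by simp
    moreover have "(mat 1 - H) ** (mat 1 - H) = mat 1 - 2 *\<^sub>R H + H ** H"
      using square[of "-1"] by simp
    ultimately show ?thesis
      by (simp add: vec_eq_iff)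
  qed
  ultimately show ?thesis
    by (simp add: H_def)
qed

lemma is_mean_arithmetic: "is_mean (\<lambda>A B :: real^'n^'n. (1/2) *\<^sub>R (A + B))"
proof -
  have congr: "transpose P ** ((1/2) *\<^sub>R (A + B)) ** P
      = (1/2) *\<^sub>R (transpose P ** A ** P + transpose P ** B ** P)" for P A B :: "real^'n^'n"
    by (simp add: matrix_add_ldistrib matrix_add_rdistrib matrix_scalar_ac scaleR_add_right
        flip: scalar_matrix_assoc)
  \<comment> \<open>Every difference in the order axioms is half of a difference assumed to be
    positive semidefinite, so after rewriting \<open>psd_scaleR\<close> applies.\<close>
  have between: "(1/2) *\<^sub>R (A + B) - A = (1/2) *\<^sub>R (B - A)"
    "B - (1/2) *\<^sub>R (A + B) = (1/2) *\<^sub>R (B - A)" for A B :: "real^'n^'n"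
    by (simp_all add: vec_eq_iff field_simps)
  have mono: "(1/2) *\<^sub>R (A' + B) - (1/2) *\<^sub>R (A + B) = (1/2) *\<^sub>R (A' - A)"
    "(1/2) *\<^sub>R (B + A') - (1/2) *\<^sub>R (B + A) = (1/2) *\<^sub>R (A' - A)" for A A' B :: "real^'n^'n"
    by (simp_all add: vec_eq_iff field_simps)
  have cont: "continuous_on (spd_mats \<times> spd_mats) (\<lambda>(A, B :: real^'n^'n). (1/2) *\<^sub>R (A + B))"
    unfolding case_prod_unfold by (intro continuous_intros)
  have comm: "(1/2) *\<^sub>R (A + B) = (1/2) *\<^sub>R (B + A)" for A B :: "real^'n^'n"
    by (simp add: add.commute)
  show ?thesis
    unfolding is_mean_def loewner_le_def between mono congr
    by (intro conjI ballI impI allI cont comm refl psd_scaleR spd_mats_scaleR spd_mats_add) simp_all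
qed

text \<open>Apart from the term \<open>\<psi> X\<close>, \<open>bregman \<psi> X K\<close> is affine
  in \<open>X\<close>. Averaging over \<open>X\<close> and \<open>Y\<close> therefore gives the
  divergence at the midpoint, corrected by a Jensen gap independent of \<open>K\<close>.\<close>

lemma fwd_symm_at_eq:
  assumes "grad \<psi> K \<in> sym_mats"
  shows "fwd_symm_at \<psi> X Y K =
    (\<psi> X + \<psi> Y) / 2 - \<psi> ((1/2) *\<^sub>R (X + Y)) + bregman \<psi> ((1/2) *\<^sub>R (X + Y)) K"
  using assms
  by (simp add: fwd_symm_at_def bregman_def frob_eq_inner inner_diff_right inner_add_right field_simps)

theorem corollary2:
  fixes \<psi> :: "real^'n^'n \<Rightarrow> real" and X Y :: "real^'n^'n"
  assumes "mirror_map \<psi>" and "X \<in> spd_mats" and "Y \<in> spd_mats"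
  shows "(\<exists>!K. is_fwd_canonical \<psi> X Y K) \<and>
    fwd_symm_at \<psi> X Y (fwd_canonical \<psi> X Y) = (\<psi> X + \<psi> Y) / 2 - \<psi> ((1/2) *\<^sub>R (X + Y))"
proof -
  define A where "A = (1/2) *\<^sub>R (X + Y)"
  have sc: "strictly_convex_on spd_mats \<psi>"
    using assms(1) by (simp add: mirror_map_def)
  then have conv: "convex (spd_mats :: (real^'n^'n) set)"
    by (simp add: strictly_convex_on_def)
  \<comment> \<open>Existence comes from the mirror map and uniqueness from the lemma above;
    together they make the description in \<open>grad\<close> meaningful.\<close>
  have grad: "has_gradient \<psi> (grad \<psi> K) K" if "K \<in> spd_mats" for K
    unfolding grad_def
  proof (rule theI')
    show "\<exists>!G. has_gradient \<psi> G K"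
      using assms(1) that has_gradient_unique[OF conv that] unfolding mirror_map_def by blast
  qed
  have A: "A \<in> spd_mats"
    unfolding A_def using assms by (simp add: spd_mats_add spd_mats_scaleR)
  \<comment> \<open>This is the strict tangent inequality with base point \<open>K\<close>,
    evaluated at \<open>A\<close>.\<close>
  have pos: "0 < bregman \<psi> A K" if "K \<in> spd_mats" "K \<noteq> A" for K
    using strictly_convex_on_above_tangent[OF sc _ that(1) A that(2)] grad[OF that(1)]
    unfolding has_gradient_def bregman_def by fastforce
  have val: "fwd_symm_at \<psi> X Y K = (\<psi> X + \<psi> Y) / 2 - \<psi> A + bregman \<psi> A K"
    if "K \<in> spd_mats" for K
    unfolding A_def using grad[OF that] by (intro fwd_symm_at_eq) (simp add: has_gradient_def)
  have "bregman \<psi> A A = 0"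
    by (simp add: bregman_def frob_def trace_def matrix_matrix_mult_def)
  with val[OF A] have valA: "fwd_symm_at \<psi> X Y A = (\<psi> X + \<psi> Y) / 2 - \<psi> A"
    by simp
  have less: "fwd_symm_at \<psi> X Y A < fwd_symm_at \<psi> X Y K" if "K \<in> spd_mats" "K \<noteq> A" for K
    using val[OF that(1)] valA pos[OF that] by simp
  have mean: "M X Y \<in> spd_mats" if "is_mean M" for M
    using that assms by (simp add: is_mean_def)
  let ?M = "\<lambda>A B :: real^'n^'n. (1/2) *\<^sub>R (A + B)"
  have "is_fwd_canonical \<psi> X Y K \<longleftrightarrow> K = A" for K
  proof
    assume "is_fwd_canonical \<psi> X Y K"
    \<comment> \<open>A minimizer is compared with the arithmetic mean, whose value at
      \<open>(X, Y)\<close> is \<open>A\<close>; any other value would be strictly worse by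
      \<open>less\<close>.\<close>
    then obtain M where "is_mean M" "K = M X Y" "\<not> fwd_symm \<psi> X Y ?M < fwd_symm \<psi> X Y M"
      using is_mean_arithmetic unfolding is_fwd_canonical_def is_arg_min_def by blast
    then show "K = A"
      using less[of K] mean by (auto simp: fwd_symm_def A_def)
  next
    assume "K = A"
    \<comment> \<open>Means other than \<open>?M\<close> may also take the value \<open>A\<close> at
      \<open>(X, Y)\<close>; they tie with it, hence the case split on the value.\<close>
    have "\<not> fwd_symm_at \<psi> X Y (M X Y) < fwd_symm_at \<psi> X Y A" if "is_mean M" for M
      using less[OF mean[OF that]] by (cases "M X Y = A") auto
    then have "is_arg_min (fwd_symm \<psi> X Y) is_mean ?M"
      using is_mean_arithmetic by (auto simp: is_arg_min_def fwd_symm_def A_def)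
    with \<open>K = A\<close> show "is_fwd_canonical \<psi> X Y K"
      unfolding is_fwd_canonical_def A_def by blast
  qed
  then show ?thesis
    using valA by (simp add: fwd_canonical_def A_def)
qed

end
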